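(* For any $0<\alpha<1$ and $u\in C^{0,0,3}_{x,y,t}(\Omega\times(0,T])$, the error $R_1$ of the discretization of the Caputo derivative at the point $(x_i,y_j,t_{n-\frac12})$ satisfies $$|R_1|=\left|D_t^{\alpha}u(x_i,y_j,t_{n-\frac12})-\frac{\tau^{1-\alpha}}{\Gamma(2-\alpha)}\sum_{k=1}^{n}c_{n-k}^{(\alpha)}\,\nabla_t u_{ij}^k\right|=O(\tau^{2-\alpha}).$$
   Context: Here $\Omega=(0,L_x)\times(0,L_y)$, and $u\in C^{0,0,3}_{x,y,t}$ indicates continuity in $x,y$ and three continuous derivatives in $t$. The mesh is uniform: $x_i=ih_x$ ($0\le i\le M_x$), $y_j=jh_y$ ($0\le j\le M_y$), $t_n=n\tau$ ($0\le n\le N$), with $h_x=L_x/M_x$, $h_y=L_y/M_y$, $\tau=T/N$; $t_{n-\frac12}=(n-\frac12)\tau$, $1\le n\le N$. Write $u_{ij}^n=u(x_i,y_j,t_n)$ and $\nabla_t u_{ij}^n=\dfrac{u_{ij}^n-u_{ij}^{n-1}}{\tau}$. The Caputo derivative of order $\alpha\in(0,1)$ is $$D_t^\alpha u(x,y,t)=\frac{1}{\Gamma(1-\alpha)}\int_0^t (t-s)^{-\alpha}\,\frac{\partial u(x,y,s)}{\partial s}\,ds .$$ Coefficients: $a_0^{(\alpha)}=(\tfrac12)^{1-\alpha}$ and, for $k\ge1$, $$a_k^{(\alpha)}=(k+\tfrac12)^{1-\alpha}-(k-\tfrac12)^{1-\alpha},$$ $$b_k^{(\alpha)}=\tfrac{1}{2-\alpha}\big[(k+\tfrac12)^{2-\alpha}-(k-\tfrac12)^{2-\alpha}\big]-\tfrac12\big[(k+\tfrac12)^{1-\alpha}+(k-\tfrac12)^{1-\alpha}\big].$$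 The coefficients $c_k^{(\alpha)}$, $0\le k\le n-1$, depend on $n$: for $n=1$, $c_0^{(\alpha)}=a_0^{(\alpha)}$; for $n\ge2$, $c_0^{(\alpha)}=a_0^{(\alpha)}+b_1^{(\alpha)}$, $c_k^{(\alpha)}=a_k^{(\alpha)}+b_{k+1}^{(\alpha)}-b_k^{(\alpha)}$ for $1\le k\le n-2$, and $c_{n-1}^{(\alpha)}=a_{n-1}^{(\alpha)}-b_{n-1}^{(\alpha)}$.
   Formalization: u and its time derivatives up to order 3 are assumed continuous on the closed set [0,L_x]×[0,L_y]×[0,T] instead of Ω×(0,T]; without regularity at t=0 the claim fails, e.g. u=t^{1/2}, α=1/2, n=1 has constant nonzero error. *)

theory Defs
  imports "HOL-Analysis.Analysis"
begin

text \<open>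
  The class of functions on \<open>S \<times> I\<close> that are continuous in space and three times
  continuously differentiable in time: \<open>D m\<close> is the \<open>m\<close>-th time derivative, and every
  \<open>D m\<close> with \<open>m \<le> 3\<close> is jointly continuous.  Derivatives are taken within \<open>I\<close>, hence they are
  one-sided at the end points of a closed time interval.
\<close>

definition C003 ::
    "(real \<times> real) set \<Rightarrow> real set \<Rightarrow> (real \<Rightarrow> real \<Rightarrow> real \<Rightarrow> real) \<Rightarrow> bool" where
  "C003 S I u \<longleftrightarrow>
     (\<exists>D :: nat \<Rightarrow> real \<Rightarrow> real \<Rightarrow> real \<Rightarrow> real.
        D 0 = u \<and>
        (\<forall>m<3. \<forall>(x, y)\<in>S. \<forall>t\<in>I. (D m x y has_real_derivative D (Suc m) x y t) (at t within I)) \<and>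
        (\<forall>m\<le>3. continuous_on (S \<times> I) (\<lambda>((x, y), t). D m x y t)))"

text \<open>
  The integrand may be singular at \<open>s = t\<close>, and \<open>deriv f\<close> is unspecified at \<open>s = 0\<close> when \<open>f\<close> is
  only one-sidedly differentiable there; neither point affects the integral.
\<close>

definition caputo :: "real \<Rightarrow> (real \<Rightarrow> real) \<Rightarrow> real \<Rightarrow> real" where
  "caputo \<alpha> f t = 1 / Gamma (1 - \<alpha>) * integral {0..t} (\<lambda>s. (t - s) powr (-\<alpha>) * deriv f s)"

definition coeff_a :: "real \<Rightarrow> nat \<Rightarrow> real" where
  "coeff_a \<alpha> k =
     (if k = 0 then (1/2) powr (1 - \<alpha>)
      else (real k + 1/2) powr (1 - \<alpha>) - (real k - 1/2) powr (1 - \<alpha>))"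

text \<open>Only used for \<open>k \<ge> 1\<close>.\<close>

definition coeff_b :: "real \<Rightarrow> nat \<Rightarrow> real" where
  "coeff_b \<alpha> k =
     1 / (2 - \<alpha>) * ((real k + 1/2) powr (2 - \<alpha>) - (real k - 1/2) powr (2 - \<alpha>))
     - 1/2 * ((real k + 1/2) powr (1 - \<alpha>) + (real k - 1/2) powr (1 - \<alpha>))"

text \<open>Only used for \<open>n \<ge> 1\<close> and \<open>k \<le> n - 1\<close>, so the last case is \<open>n \<ge> 2\<close>, \<open>k = n - 1\<close>.\<close>

definition coeff_c :: "real \<Rightarrow> nat \<Rightarrow> nat \<Rightarrow> real" where
  "coeff_c \<alpha> n k =
     (if n = 1 then coeff_a \<alpha> 0
      else if k = 0 then coeff_a \<alpha> 0 + coeff_b \<alpha> 1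
      else if k \<le> n - 2 then coeff_a \<alpha> k + coeff_b \<alpha> (k + 1) - coeff_b \<alpha> k
      else coeff_a \<alpha> (n - 1) - coeff_b \<alpha> (n - 1))"

definition backward_diff :: "real \<Rightarrow> (real \<Rightarrow> real) \<Rightarrow> nat \<Rightarrow> real" where
  "backward_diff \<tau> f n = (f (real n * \<tau>) - f ((real n - 1) * \<tau>)) / \<tau>"

definition caputo_discr :: "real \<Rightarrow> real \<Rightarrow> (real \<Rightarrow> real) \<Rightarrow> nat \<Rightarrow> real" where
  "caputo_discr \<alpha> \<tau> f n =
     \<tau> powr (1 - \<alpha>) / Gamma (2 - \<alpha>) * (\<Sum>k=1..n. coeff_c \<alpha> n (n - k) * backward_diff \<tau> f k)"

end

theory Submission imports Defs begin

text \<open>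
  Put \<open>t = (n - 1/2) \<tau>\<close> and let \<open>d\<^sub>k\<close> be the backward difference at \<open>k \<tau>\<close>.  The discretization is
  \<open>1 / \<Gamma>(1 - \<alpha>)\<close> times the integral of \<open>(t - s)\<^sup>-\<^sup>\<alpha> P(s)\<close>, where \<open>P\<close> is the derivative of a piecewise interpolant: on
  \<open>[(k-1) \<tau>, k \<tau>]\<close> with \<open>k < n\<close> it is the quadratic one through the nodes \<open>k-1, k, k+1\<close>, so
  \<open>P(s) = d\<^sub>k + (s - (k - 1/2) \<tau>) (d\<^sub>k\<^sub>+\<^sub>1 - d\<^sub>k) / \<tau>\<close>, and on the last half interval it is \<open>d\<^sub>n\<close>.
  By Taylor's theorem \<open>P\<close> differs from the derivative by \<open>O(\<tau>\<^sup>2)\<close> on the history part, where the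
  kernel has bounded integral, and by \<open>O(\<tau>)\<close> on the last half interval, where the integral of the
  kernel is \<open>O(\<tau>\<^sup>1\<^sup>-\<^sup>\<alpha>)\<close>.  The constants involve only bounds on the second and third time
  derivatives, which are uniform in space by compactness.
\<close>

section \<open>Integrals against the weakly singular kernel\<close>

text \<open>Since \<open>s - c = (t - c) - (t - s)\<close>, the integrand is a combination of pure
  powers of \<open>t - s\<close>, each with an elementary antiderivative.\<close>

lemma powr_kernel_linear_has_integral:
  fixes \<alpha> t a b c p q :: real
  assumes "\<alpha> < 1" "a \<le> b" "b \<le> t"
  shows "((\<lambda>s. (t - s) powr (-\<alpha>) * (p + q * (s - c))) has_integral
           (p + q * (t - c)) * (((t - a) powr (1 - \<alpha>) - (t - b) powr (1 - \<alpha>)) / (1 - \<alpha>))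
           - q * (((t - a) powr (2 - \<alpha>) - (t - b) powr (2 - \<alpha>)) / (2 - \<alpha>))) {a..b}"
proof -
  define F where "F = (\<lambda>s. - (p + q * (t - c)) * ((t - s) powr (1 - \<alpha>) / (1 - \<alpha>))
                         + q * ((t - s) powr (2 - \<alpha>) / (2 - \<alpha>)))"
  have "((\<lambda>s. (t - s) powr (-\<alpha>) * (p + q * (s - c))) has_integral (F b - F a)) {a..b}"
  \<comment> \<open>For \<open>b = t\<close> the antiderivative need not be differentiable at
    \<open>b\<close>, but it is continuous there because \<open>1 - \<alpha>\<close> and
    \<open>2 - \<alpha>\<close> are positive. Hence derivatives are taken in the open interval
    only.\<close>
  proof (rule fundamental_theorem_of_calculus_interior)
    show "continuous_on {a..b} F"
      unfolding F_def using assms by (intro continuous_intros continuous_on_powr') auto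
    fix s assume s: "s \<in> {a<..<b}"
    then have pos: "0 < t - s" using assms by auto
    have D: "((\<lambda>s. (t - s) powr r / r) has_real_derivative - ((t - s) powr (r - 1))) (at s)"
      if "0 < r" for r
      using pos that by (auto intro!: derivative_eq_intros)
    have "(F has_real_derivative
            (p + q * (t - c)) * (t - s) powr (-\<alpha>) - q * (t - s) powr (1 - \<alpha>)) (at s)"
      unfolding F_def
    proof (rule DERIV_cong[OF DERIV_add[OF DERIV_cmult DERIV_cmult]])
      show "((\<lambda>s. (t - s) powr (1 - \<alpha>) / (1 - \<alpha>)) has_real_derivative - ((t - s) powr (-\<alpha>))) (at s)"
        using D[of "1 - \<alpha>"] assms by simp
      show "((\<lambda>s. (t - s) powr (2 - \<alpha>) / (2 - \<alpha>)) has_real_derivative - ((t - s) powr (1 - \<alpha>))) (at s)"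
        using D[of "2 - \<alpha>"] assms by simp
    qed (simp add: algebra_simps)
    also have "(t - s) powr (1 - \<alpha>) = (t - s) powr (-\<alpha>) * (t - s)"
      using pos powr_add[of "t - s" "-\<alpha>" 1] by simp
    also have "(p + q * (t - c)) * (t - s) powr (-\<alpha>) - q * ((t - s) powr (-\<alpha>) * (t - s))
               = (t - s) powr (-\<alpha>) * (p + q * (s - c))"
      by (simp add: algebra_simps)
    finally show "(F has_vector_derivative (t - s) powr (-\<alpha>) * (p + q * (s - c))) (at s)"
      by (simp add: has_real_derivative_iff_has_vector_derivative)
  qed (use assms in auto)
  also have "F b - F a = (p + q * (t - c)) * (((t - a) powr (1 - \<alpha>) - (t - b) powr (1 - \<alpha>)) / (1 - \<alpha>))
           - q * (((t - a) powr (2 - \<alpha>) - (t - b) powr (2 - \<alpha>)) / (2 - \<alpha>))"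
    unfolding F_def diff_divide_distrib right_diff_distrib[of "p + q * (t - c)"]
      right_diff_distrib[of q "_ / _"] mult_minus_left by simp
  finally show ?thesis .
qed

lemma powr_kernel_has_integral:
  fixes \<alpha> t a b :: real
  assumes "\<alpha> < 1" "a \<le> b" "b \<le> t"
  shows "((\<lambda>s. (t - s) powr (-\<alpha>)) has_integral
           ((t - a) powr (1 - \<alpha>) - (t - b) powr (1 - \<alpha>)) / (1 - \<alpha>)) {a..b}"
  using powr_kernel_linear_has_integral[OF assms, of 1 0] by simp

text \<open>When \<open>b = t\<close> the kernel may be unbounded, so the product need not be
  continuous. The kernel is nonnegative with a finite integral, hence absolutely integrable, and a
  bounded measurable factor preserves this.\<close>

lemma powr_kernel_continuous_integrable:
  fixes \<alpha> t a b :: real and g :: "real \<Rightarrow> real"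
  assumes "\<alpha> < 1" "a \<le> b" "b \<le> t" "continuous_on {a..b} g"
  shows "(\<lambda>s. (t - s) powr (-\<alpha>) * g s) integrable_on {a..b}"
proof -
  have "(\<lambda>s. (t - s) powr (-\<alpha>)) absolutely_integrable_on {a..b}"
    using powr_kernel_has_integral[OF assms(1-3)]
    by (intro nonnegative_absolutely_integrable_1) (auto simp: integrable_on_def)
  moreover have "g \<in> borel_measurable (lebesgue_on {a..b})"
    using assms by (intro continuous_imp_measurable_on_sets_lebesgue) auto
  moreover have "bounded (g ` {a..b})"
    using assms by (intro compact_imp_bounded compact_continuous_image) auto
  ultimately have "(\<lambda>s. g s * (t - s) powr (-\<alpha>)) absolutely_integrable_on {a..b}"
    by (intro absolutely_integrable_bounded_measurable_product_real) auto
  then show ?thesis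
    by (simp add: mult.commute absolutely_integrable_on_def)
qed

text \<open>The kernel is nonnegative, so a pointwise bound on \<open>g - h\<close> is merely
  multiplied by its integral. The error on each interval is estimated this way, with
  \<open>g\<close> the true derivative and \<open>h\<close> that of an interpolant.\<close>

lemma powr_kernel_integral_diff_le:
  fixes \<alpha> t a b B :: real and g h :: "real \<Rightarrow> real"
  assumes "\<alpha> < 1" "a \<le> b" "b \<le> t" "continuous_on {a..b} g"
    and h: "((\<lambda>s. (t - s) powr (-\<alpha>) * h s) has_integral H) {a..b}"
    and bound: "\<And>s. s \<in> {a..b} \<Longrightarrow> \<bar>g s - h s\<bar> \<le> B"
  shows "\<bar>integral {a..b} (\<lambda>s. (t - s) powr (-\<alpha>) * g s) - H\<bar>
           \<le> B * (((t - a) powr (1 - \<alpha>) - (t - b) powr (1 - \<alpha>)) / (1 - \<alpha>))"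
proof -
  let ?w = "\<lambda>s. (t - s) powr (-\<alpha>)"
  have diff: "((\<lambda>s. ?w s * g s - ?w s * h s) has_integral integral {a..b} (\<lambda>s. ?w s * g s) - H) {a..b}"
    using powr_kernel_continuous_integrable[OF assms(1-4)] h
    by (intro has_integral_diff) (auto simp: integrable_integral)
  have B: "((\<lambda>s. B * ?w s) has_integral
      B * (((t - a) powr (1 - \<alpha>) - (t - b) powr (1 - \<alpha>)) / (1 - \<alpha>))) {a..b}"
    by (intro has_integral_mult_right powr_kernel_has_integral assms)
  have le: "norm (?w s * g s - ?w s * h s) \<le> B * ?w s" if "s \<in> {a..b}" for s
  proof -
    have "norm (?w s * g s - ?w s * h s) = \<bar>g s - h s\<bar> * ?w s"
      by (simp add: abs_mult flip: right_diff_distrib)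
    also have "\<dots> \<le> B * ?w s"
      using bound[OF that] by (intro mult_right_mono) auto
    finally show ?thesis .
  qed
  show ?thesis
    using integral_norm_bound_integral[OF has_integral_integrable[OF diff] has_integral_integrable[OF B] le]
    unfolding integral_unique[OF diff] integral_unique[OF B] real_norm_def by simp
qed

section \<open>Interpolation weights and the coefficients of the scheme\<close>

text \<open>The coefficient \<open>b\<^sub>m\<close> is the moment \<open>(1 - \<alpha>) \<integral> (m - v) v\<^sup>-\<^sup>\<alpha> dv\<close> over \<open>[m - 1/2, m + 1/2]\<close>,
  where \<open>v = (t - s) / \<tau>\<close>.\<close>

lemma interpolant_has_integral:
  fixes \<alpha> \<tau> p q :: real and n k :: nat
  assumes "\<alpha> < 1" "0 < \<tau>" "1 \<le> k" "k < n"
  shows "((\<lambda>s. ((real n - 1/2) * \<tau> - s) powr (-\<alpha>) * (p + (q - p) / \<tau> * (s - (real k - 1/2) * \<tau>)))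
           has_integral \<tau> powr (1 - \<alpha>) / (1 - \<alpha>) * (coeff_a \<alpha> (n - k) * p + coeff_b \<alpha> (n - k) * (q - p)))
           {(real k - 1) * \<tau>..real k * \<tau>}"
proof -
  define m where "m = real n - real k"
  define A B where "A = (m + 1/2) powr (1 - \<alpha>)" and "B = (m - 1/2) powr (1 - \<alpha>)"
  have m: "1 \<le> m" "real (n - k) = m" using assms by (auto simp: m_def)
  have t1: "(real n - 1/2) * \<tau> - (real k - 1) * \<tau> = (m + 1/2) * \<tau>"
    and t2: "(real n - 1/2) * \<tau> - real k * \<tau> = (m - 1/2) * \<tau>"
    and t3: "(real n - 1/2) * \<tau> - (real k - 1/2) * \<tau> = m * \<tau>"
    by (simp_all add: m_def algebra_simps)
  have le: "(real k - 1) * \<tau> \<le> real k * \<tau>" "real k * \<tau> \<le> (real n - 1/2) * \<tau>"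
    using assms m by (auto simp: m_def)
  have pw: "x powr (2 - \<alpha>) = x * x powr (1 - \<alpha>)" if "0 < x" for x
  proof -
    have "x powr (2 - \<alpha>) = x powr (1 + (1 - \<alpha>))" by simp
    then show ?thesis using that by (simp only: powr_add) simp
  qed
  have A2: "(m + 1/2) powr (2 - \<alpha>) = (m + 1/2) * A" and B2: "(m - 1/2) powr (2 - \<alpha>) = (m - 1/2) * B"
    and T2: "\<tau> powr (2 - \<alpha>) = \<tau> * \<tau> powr (1 - \<alpha>)"
    unfolding A_def B_def using m assms by (auto intro!: pw)
  have a: "coeff_a \<alpha> (n - k) = A - B"
    using assms by (simp add: coeff_a_def A_def B_def m)
  have b: "coeff_b \<alpha> (n - k) = 1 / (2 - \<alpha>) * ((m + 1/2) * A - (m - 1/2) * B) - 1/2 * (A + B)"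
    unfolding coeff_b_def m(2) A2 B2 A_def B_def by simp
  have scale: "((m + 1/2) * \<tau>) powr r = (m + 1/2) powr r * \<tau> powr r"
    "((m - 1/2) * \<tau>) powr r = (m - 1/2) powr r * \<tau> powr r" for r
    using m assms by (auto simp: powr_mult)
  \<comment> \<open>Put \<open>X = (m + 1/2) * A - (m - 1/2) * B = m * (A - B) + (A + B) /
    2\<close>. Up to the common factor, \<open>q - p\<close> is multiplied by \<open>m * (A - B) -
    (1 - \<alpha>) / (2 - \<alpha>) * X = X / (2 - \<alpha>) - (A + B) / 2\<close>, which is the
    coefficient \<open>coeff_b\<close>.\<close>
  have "(p + (q - p) / \<tau> * (m * \<tau>)) * ((A * \<tau> powr (1 - \<alpha>) - B * \<tau> powr (1 - \<alpha>)) / (1 - \<alpha>))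
        - (q - p) / \<tau> * (((m + 1/2) * A * (\<tau> * \<tau> powr (1 - \<alpha>)) - (m - 1/2) * B * (\<tau> * \<tau> powr (1 - \<alpha>))) / (2 - \<alpha>))
      = \<tau> powr (1 - \<alpha>) / (1 - \<alpha>) * (coeff_a \<alpha> (n - k) * p + coeff_b \<alpha> (n - k) * (q - p))"
    unfolding a b using assms by (simp add: divide_simps) (simp add: algebra_simps)
  then show ?thesis
    using powr_kernel_linear_has_integral[OF assms(1) le, of p "(q - p) / \<tau>" "(real k - 1/2) * \<tau>"]
    unfolding t1 t2 t3 scale A2 B2 T2 by (simp only: flip: A_def B_def)
qed

text \<open>Collecting the interval contributions by \<open>d k\<close> explains the cases of
  \<open>coeff_c\<close>: an inner \<open>d k\<close> takes \<open>- coeff_b\<close> from its own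
  interval and \<open>+ coeff_b\<close> from the one before, while \<open>d 1\<close> has no
  interval before it and \<open>d n\<close> has no full interval of its own.\<close>

lemma caputo_discr_sum:
  fixes d :: "nat \<Rightarrow> real"
  assumes "1 \<le> n"
  shows "(\<Sum>k=1..n. coeff_c \<alpha> n (n - k) * d k)
           = coeff_a \<alpha> 0 * d n
             + (\<Sum>k=1..n-1. coeff_a \<alpha> (n - k) * d k + coeff_b \<alpha> (n - k) * (d (Suc k) - d k))"
proof (cases "n = 1")
  case True
  then show ?thesis by (simp add: coeff_c_def)
next
  case False
  with assms obtain m where n: "n = Suc m" and m: "1 \<le> m" by (cases n) auto
  \<comment> \<open>The share of \<open>d k\<close> that comes from interval \<open>k - 1\<close>,
    hence the index \<open>n - (k - 1)\<close>; for \<open>k = 1\<close> there is no such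
    interval.\<close>
  define \<beta> where "\<beta> k = (if 1 < k then coeff_b \<alpha> (Suc n - k) * d k else 0)" for k
  have c: "coeff_c \<alpha> n (n - k) * d k = coeff_a \<alpha> (n - k) * d k - coeff_b \<alpha> (n - k) * d k + \<beta> k"
    if "k \<in> {1..m}" for k
    using that m unfolding \<beta>_def n coeff_c_def
    by (auto simp: Suc_diff_le algebra_simps)
  have "(\<Sum>k=1..n. coeff_c \<alpha> n (n - k) * d k)
        = (\<Sum>k=1..m. coeff_c \<alpha> n (n - k) * d k) + coeff_c \<alpha> n 0 * d n"
    by (simp add: n)
  also have "(\<Sum>k=1..m. coeff_c \<alpha> n (n - k) * d k)
        = (\<Sum>k=1..m. coeff_a \<alpha> (n - k) * d k - coeff_b \<alpha> (n - k) * d k + \<beta> k)"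
    by (intro sum.cong refl c)
  also have "coeff_c \<alpha> n 0 * d n = coeff_a \<alpha> 0 * d n + \<beta> n"
    using m by (simp add: n coeff_c_def \<beta>_def distrib_right)
  also have "(\<Sum>k=1..m. coeff_a \<alpha> (n - k) * d k - coeff_b \<alpha> (n - k) * d k + \<beta> k)
          + (coeff_a \<alpha> 0 * d n + \<beta> n) = (\<Sum>k=1..m. coeff_a \<alpha> (n - k) * d k - coeff_b \<alpha> (n - k) * d k)
          + coeff_a \<alpha> 0 * d n + (\<Sum>k=1..n. \<beta> k)"
    by (simp add: n sum.distrib)
  also have "(\<Sum>k=1..n. \<beta> k) = (\<Sum>k=2..n. \<beta> k)"
    by (rule sum.mono_neutral_right) (auto simp: \<beta>_def)
  also have "\<dots> = (\<Sum>k=1..m. \<beta> (Suc k))"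
    unfolding n numeral_2_eq_2 One_nat_def by (rule sum.shift_bounds_cl_Suc_ivl)
  also have "\<dots> = (\<Sum>k=1..m. coeff_b \<alpha> (n - k) * d (Suc k))"
    by (intro sum.cong) (auto simp: \<beta>_def)
  finally show ?thesis
    by (simp add: n algebra_simps flip: sum.distrib)
qed

section \<open>Local errors of the derivatives of the interpolants\<close>

text \<open>Derivatives within \<open>{0..T}\<close> make the expansion valid up to both end points,
  where mesh nodes may lie. The remainder carries \<open>fact m\<close> instead of the sharper
  \<open>fact (Suc m)\<close>, which affects only constants.\<close>

lemma Taylor_real_within:
  fixes g :: "nat \<Rightarrow> real \<Rightarrow> real"
  assumes "\<And>i x. x \<in> {0..T} \<Longrightarrow> i \<le> m \<Longrightarrow> (g i has_real_derivative g (Suc i) x) (at x within {0..T})"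
    and "\<And>x. x \<in> {0..T} \<Longrightarrow> \<bar>g (Suc m) x\<bar> \<le> M"
    and "s \<in> {0..T}" "x \<in> {0..T}" "\<bar>x - s\<bar> \<le> r"
  shows "\<bar>g 0 x - (\<Sum>i\<le>m. g i s * (x - s) ^ i / fact i)\<bar> \<le> M * r ^ Suc m / fact m"
proof -
  have "0 \<le> M" using assms(2)[OF assms(3)] by linarith
  have "\<bar>g 0 x - (\<Sum>i\<le>m. g i s * (x - s) ^ i / fact i)\<bar> \<le> M * \<bar>x - s\<bar> ^ Suc m / fact m"
    using field_Taylor[of "{0..T}" m g M s x] assms by simp
  also have "\<dots> \<le> M * r ^ Suc m / fact m"
    using assms(5) \<open>0 \<le> M\<close> by (intro divide_right_mono mult_left_mono power_mono) auto
  finally show ?thesis .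
qed

text \<open>A difference quotient is exact on the linear Taylor polynomial at \<open>s\<close>, so
  only the remainders at the two nodes survive, divided by \<tau>. As \<open>s\<close> is arbitrary
  in the interval, the extra order at the midpoint cannot be used.\<close>

lemma backward_diff_error:
  fixes g :: "nat \<Rightarrow> real \<Rightarrow> real"
  assumes "\<And>i x. x \<in> {0..T} \<Longrightarrow> i < 3 \<Longrightarrow> (g i has_real_derivative g (Suc i) x) (at x within {0..T})"
    and "\<And>x. x \<in> {0..T} \<Longrightarrow> \<bar>g 2 x\<bar> \<le> M"
    and "0 < \<tau>" "1 \<le> n" "real n * \<tau> \<le> T"
    and s: "s \<in> {(real n - 1) * \<tau>..real n * \<tau>}"
  shows "\<bar>g 1 s - backward_diff \<tau> (g 0) n\<bar> \<le> 2 * M * \<tau>"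
proof -
  have "0 \<le> (real n - 1) * \<tau>" using assms by simp
  moreover have "(real n - 1) * \<tau> \<le> real n * \<tau>" using assms by simp
  ultimately have in_T: "s \<in> {0..T}" "real n * \<tau> \<in> {0..T}" "(real n - 1) * \<tau> \<in> {0..T}"
    using s assms(5) unfolding atLeastAtMost_iff by linarith+
  have R: "\<bar>g 0 x - (g 0 s + g 1 s * (x - s))\<bar> \<le> M * \<tau>\<^sup>2"
    if "x \<in> {0..T}" "\<bar>x - s\<bar> \<le> \<tau>" for x
    using Taylor_real_within[of T 1 g M s x \<tau>] assms that in_T
    by (simp add: numeral_2_eq_2)
  define R where "R x = g 0 x - (g 0 s + g 1 s * (x - s))" for x
  have "\<bar>R (real n * \<tau>)\<bar> \<le> M * \<tau>\<^sup>2" "\<bar>R ((real n - 1) * \<tau>)\<bar> \<le> M * \<tau>\<^sup>2"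
    unfolding R_def using s in_T by (auto intro!: R[unfolded One_nat_def] simp: left_diff_distrib)
  then have "\<bar>R ((real n - 1) * \<tau>) - R (real n * \<tau>)\<bar> / \<tau> \<le> 2 * M * \<tau>\<^sup>2 / \<tau>"
    using assms by (intro divide_right_mono) auto
  moreover have "g 1 s - backward_diff \<tau> (g 0) n = (R ((real n - 1) * \<tau>) - R (real n * \<tau>)) / \<tau>"
    using assms(3) by (simp add: backward_diff_def R_def field_simps)
  ultimately show ?thesis
    using assms(3) by (simp add: power2_eq_square)
qed

text \<open>The derivative of the quadratic interpolant is exact on quadratics, so the error comes
  only from the third-order Taylor remainders at the three nodes.\<close>

lemma quadratic_interpolant_error:
  fixes g :: "nat \<Rightarrow> real \<Rightarrow> real"
  assumes "\<And>i x. x \<in> {0..T} \<Longrightarrow> i < 3 \<Longrightarrow> (g i has_real_derivative g (Suc i) x) (at x within {0..T})"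
    and "\<And>x. x \<in> {0..T} \<Longrightarrow> \<bar>g 3 x\<bar> \<le> M"
    and "0 < \<tau>" "1 \<le> k" "real (Suc k) * \<tau> \<le> T"
    and s: "s \<in> {(real k - 1) * \<tau>..real k * \<tau>}"
  shows "\<bar>g 1 s - (backward_diff \<tau> (g 0) k
            + (backward_diff \<tau> (g 0) (Suc k) - backward_diff \<tau> (g 0) k) / \<tau> * (s - (real k - 1/2) * \<tau>))\<bar>
         \<le> 16 * M * \<tau>\<^sup>2"
proof -
  have k0: "0 \<le> (real k - 1) * \<tau>" using assms by simp
  define x0 x1 x2 where "x0 = (real k - 1) * \<tau>" and "x1 = real k * \<tau>" and "x2 = real (Suc k) * \<tau>"
  have x: "x1 = x0 + \<tau>" "x2 = x0 + 2 * \<tau>" "(real k - 1/2) * \<tau> = x0 + \<tau> / 2"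
    by (simp_all add: x0_def x1_def x2_def algebra_simps)
  have in_T: "s \<in> {0..T}" "x0 \<in> {0..T}" "x1 \<in> {0..T}" "x2 \<in> {0..T}"
    and near: "x0 \<le> s" "s \<le> x0 + \<tau>"
    using s assms(3,5) k0 x unfolding atLeastAtMost_iff x0_def[symmetric] x1_def[symmetric] x2_def[symmetric]
    by linarith+
  define R where "R x = g 0 x - (g 0 s + g 1 s * (x - s) + g 2 s * (x - s)\<^sup>2 / 2)" for x
  \<comment> \<open>Each node lies within \<open>2 * \<tau>\<close> of \<open>s\<close>, and
    \<open>M * (2 * \<tau>) ^ 3 / 2 = 4 * M * \<tau> ^ 3\<close>.\<close>
  have R: "\<bar>R x\<bar> \<le> 4 * M * \<tau> ^ 3"
    if "x \<in> {0..T}" "\<bar>x - s\<bar> \<le> 2 * \<tau>" for x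
    using Taylor_real_within[of T 2 g M s x "2 * \<tau>"] assms that in_T
    by (simp add: R_def numeral_2_eq_2 numeral_3_eq_3 algebra_simps)
  have R012: "\<bar>R x0\<bar> \<le> 4 * M * \<tau> ^ 3" "\<bar>R x1\<bar> \<le> 4 * M * \<tau> ^ 3" "\<bar>R x2\<bar> \<le> 4 * M * \<tau> ^ 3"
    using in_T near x assms(3) by (auto intro!: R)
  \<comment> \<open>The offset of \<open>s\<close> from the midpoint of \<open>x0\<close> and
    \<open>x1\<close>, in units of \<tau>.\<close>
  define \<theta> where "\<theta> = (s - (x0 + \<tau> / 2)) / \<tau>"
  have \<theta>: "\<bar>\<theta>\<bar> \<le> 1 / 2" and s_eq: "s = x0 + \<tau> / 2 + \<theta> * \<tau>"
    using near assms(3) by (auto simp: \<theta>_def field_simps abs_le_iff)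
  \<comment> \<open>This is \<tau> times the derivative of the interpolant at \<open>s\<close>, with
    the remainders \<open>R\<close> in place of the nodal values of \<open>g 0\<close>.\<close>
  define E where "E = (R x1 - R x0) + \<theta> * (R x2 - 2 * R x1 + R x0)"
  have "\<bar>E\<bar> \<le> \<bar>R x1 - R x0\<bar> + \<bar>\<theta>\<bar> * \<bar>R x2 - 2 * R x1 + R x0\<bar>"
    unfolding E_def by (metis abs_mult abs_triangle_ineq)
  also have "\<dots> \<le> 8 * M * \<tau> ^ 3 + 1 / 2 * (16 * M * \<tau> ^ 3)"
    using R012 \<theta> by (intro add_mono mult_mono) auto
  finally have E: "\<bar>E\<bar> \<le> 16 * M * \<tau> ^ 3" by simp
  have d: "backward_diff \<tau> (g 0) k = (g 0 x1 - g 0 x0) / \<tau>"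
    "backward_diff \<tau> (g 0) (Suc k) = (g 0 x2 - g 0 x1) / \<tau>"
    by (simp_all add: backward_diff_def x0_def x1_def x2_def)
  have "g 1 s - (backward_diff \<tau> (g 0) k
      + (backward_diff \<tau> (g 0) (Suc k) - backward_diff \<tau> (g 0) k) / \<tau> * (s - (real k - 1/2) * \<tau>))
      = g 1 s - ((g 0 x1 - g 0 x0) + \<theta> * (g 0 x2 - 2 * g 0 x1 + g 0 x0)) / \<tau>"
    unfolding d x \<theta>_def using assms(3) by (simp add: field_simps)
  \<comment> \<open>The quadratic Taylor terms cancel: their first difference is
    \<open>- \<theta> * \<tau>\<^sup>2 * g 2 s\<close>, and \<theta> times their second difference
    is the opposite. The linear terms leave \<open>\<tau> * g 1 s\<close>.\<close>
  also have "(g 0 x1 - g 0 x0) + \<theta> * (g 0 x2 - 2 * g 0 x1 + g 0 x0) = \<tau> * g 1 s + E"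
  proof -
    have g0: "g 0 y = R y + (g 0 s + g 1 s * (y - s) + g 2 s * (y - s)\<^sup>2 / 2)" for y
      by (simp add: R_def)
    have diffs: "x0 - s = - \<tau> / 2 - \<theta> * \<tau>" "x1 - s = \<tau> / 2 - \<theta> * \<tau>" "x2 - s = 3 * \<tau> / 2 - \<theta> * \<tau>"
      using s_eq x by simp_all
    show ?thesis
      unfolding g0[of x0] g0[of x1] g0[of x2] diffs E_def by (simp add: power2_eq_square field_simps)
  qed
  also have "g 1 s - (\<tau> * g 1 s + E) / \<tau> = - (E / \<tau>)"
    using assms(3) by (simp add: field_simps)
  also have "\<bar>- (E / \<tau>)\<bar> \<le> 16 * M * \<tau> ^ 3 / \<tau>"
    using E assms(3) by (simp add: divide_right_mono)
  also have "\<dots> = 16 * M * \<tau>\<^sup>2"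
    using assms(3) by (simp add: power2_eq_square power3_eq_cube)
  finally show ?thesis .
qed


section \<open>Errors over the history and the last half interval\<close>

text \<open>Intervals are added one at a time. Their error bounds share the factor
  \<open>16 * M * \<tau>\<^sup>2\<close> and the kernel integrals telescope, so the errors do not
  accumulate with \<open>m\<close>. The condition \<open>m < n\<close> keeps the forward node
  \<open>(m + 1) * \<tau>\<close> of the last interval within \<open>n * \<tau>\<close>.\<close>

lemma history_error:
  fixes g :: "nat \<Rightarrow> real \<Rightarrow> real" and m n :: nat
  assumes "\<alpha> < 1"
    and deriv: "\<And>i x. x \<in> {0..T} \<Longrightarrow> i < 3 \<Longrightarrow> (g i has_real_derivative g (Suc i) x) (at x within {0..T})"
    and M: "\<And>x. x \<in> {0..T} \<Longrightarrow> \<bar>g 3 x\<bar> \<le> M"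
    and "0 < \<tau>" "real n * \<tau> \<le> T" "m < n"
  defines "t \<equiv> (real n - 1/2) * \<tau>" and "d \<equiv> backward_diff \<tau> (g 0)"
  shows "\<bar>integral {0..real m * \<tau>} (\<lambda>s. (t - s) powr (-\<alpha>) * g 1 s)
           - \<tau> powr (1 - \<alpha>) / (1 - \<alpha>)
             * (\<Sum>k=1..m. coeff_a \<alpha> (n - k) * d k + coeff_b \<alpha> (n - k) * (d (Suc k) - d k))\<bar>
         \<le> 16 * M * \<tau>\<^sup>2 * ((t powr (1 - \<alpha>) - (t - real m * \<tau>) powr (1 - \<alpha>)) / (1 - \<alpha>))"
  using \<open>m < n\<close>
proof (induction m)
  case 0
  then show ?case by simp
next
  case (Suc m)
  let ?w = "\<lambda>s. (t - s) powr (-\<alpha>) * g 1 s"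
  let ?piece = "coeff_a \<alpha> (n - Suc m) * d (Suc m) + coeff_b \<alpha> (n - Suc m) * (d (Suc (Suc m)) - d (Suc m))"
  define a b where "a = real m * \<tau>" and "b = real (Suc m) * \<tau>"
  have "real (Suc m) * \<tau> \<le> (real n - 1/2) * \<tau>" "real (Suc (Suc m)) * \<tau> \<le> real n * \<tau>"
    using Suc.prems \<open>0 < \<tau>\<close> by (auto intro!: mult_right_mono simp del: of_nat_Suc)
  then have bt: "b \<le> t" "real (Suc (Suc m)) * \<tau> \<le> T" "b \<le> T"
    using assms(4,5) by (auto simp: b_def t_def algebra_simps)
  have ab: "0 \<le> a" "a \<le> b" using \<open>0 < \<tau>\<close> by (auto simp: a_def b_def)
  have cont: "continuous_on {0..T} (g 1)"
    using deriv[of _ 1] by (intro DERIV_continuous_on) auto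
  have cont_b: "continuous_on {0..b} (g 1)" "continuous_on {a..b} (g 1)"
    by (rule continuous_on_subset[OF cont], use ab bt in simp)+
  have piece: "\<bar>integral {a..b} ?w - \<tau> powr (1 - \<alpha>) / (1 - \<alpha>) * ?piece\<bar>
      \<le> 16 * M * \<tau>\<^sup>2 * (((t - a) powr (1 - \<alpha>) - (t - b) powr (1 - \<alpha>)) / (1 - \<alpha>))"
  proof (rule powr_kernel_integral_diff_le[OF \<open>\<alpha> < 1\<close> ab(2) bt(1) cont_b(2)])
    have eq: "(real (Suc m) - 1) * \<tau> = a" by (simp add: a_def)
    show "((\<lambda>s. (t - s) powr (-\<alpha>) * (d (Suc m)
        + (d (Suc (Suc m)) - d (Suc m)) / \<tau> * (s - (real (Suc m) - 1/2) * \<tau>))) has_integral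
        \<tau> powr (1 - \<alpha>) / (1 - \<alpha>) * ?piece) {a..b}"
      using interpolant_has_integral[OF \<open>\<alpha> < 1\<close> \<open>0 < \<tau>\<close> _ Suc.prems] unfolding t_def b_def eq by simp
    show "\<bar>g 1 s - (d (Suc m)
        + (d (Suc (Suc m)) - d (Suc m)) / \<tau> * (s - (real (Suc m) - 1/2) * \<tau>))\<bar> \<le> 16 * M * \<tau>\<^sup>2"
      if "s \<in> {a..b}" for s
      unfolding d_def
      by (rule quadratic_interpolant_error[OF deriv M \<open>0 < \<tau>\<close> _ bt(2)]) (use that in \<open>auto simp: a_def b_def\<close>)
  qed
  have "?w integrable_on {0..b}"
    using ab bt cont_b by (intro powr_kernel_continuous_integrable \<open>\<alpha> < 1\<close>) auto
  then have "integral {0..b} ?w = integral {0..a} ?w + integral {a..b} ?w"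
    using ab by (simp add: Henstock_Kurzweil_Integration.integral_combine)
  moreover have "\<bar>integral {0..a} ?w - \<tau> powr (1 - \<alpha>) / (1 - \<alpha>)
      * (\<Sum>k=1..m. coeff_a \<alpha> (n - k) * d k + coeff_b \<alpha> (n - k) * (d (Suc k) - d k))\<bar>
      \<le> 16 * M * \<tau>\<^sup>2 * ((t powr (1 - \<alpha>) - (t - a) powr (1 - \<alpha>)) / (1 - \<alpha>))"
    using Suc unfolding a_def by simp
  moreover have "16 * M * \<tau>\<^sup>2 * ((t powr (1 - \<alpha>) - (t - a) powr (1 - \<alpha>)) / (1 - \<alpha>))
      + 16 * M * \<tau>\<^sup>2 * (((t - a) powr (1 - \<alpha>) - (t - b) powr (1 - \<alpha>)) / (1 - \<alpha>))
      = 16 * M * \<tau>\<^sup>2 * ((t powr (1 - \<alpha>) - (t - b) powr (1 - \<alpha>)) / (1 - \<alpha>))"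
    by (simp add: algebra_simps flip: add_divide_distrib)
  ultimately show ?case
    using piece unfolding b_def[symmetric] by (simp add: distrib_left)
qed

text \<open>In the constant, \<open>16 * T\<close> stems from the history and \<open>2\<close> from
  the last half interval. The factor \<open>1 / (1 - \<alpha>)\<close> of the kernel integrals turns
  \<open>Gamma (1 - \<alpha>)\<close> into \<open>Gamma (2 - \<alpha>)\<close>.\<close>

lemma caputo_discr_error:
  fixes g :: "nat \<Rightarrow> real \<Rightarrow> real" and n :: nat
  assumes "0 < \<alpha>" "\<alpha> < 1"
    and deriv: "\<And>i x. x \<in> {0..T} \<Longrightarrow> i < 3 \<Longrightarrow> (g i has_real_derivative g (Suc i) x) (at x within {0..T})"
    and M: "\<And>x. x \<in> {0..T} \<Longrightarrow> \<bar>g 2 x\<bar> \<le> M" "\<And>x. x \<in> {0..T} \<Longrightarrow> \<bar>g 3 x\<bar> \<le> M"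
    and "0 < \<tau>" "1 \<le> n" "real n * \<tau> \<le> T"
  shows "\<bar>caputo \<alpha> (g 0) ((real n - 1/2) * \<tau>) - caputo_discr \<alpha> \<tau> (g 0) n\<bar>
           \<le> (16 * T + 2) * M / Gamma (2 - \<alpha>) * \<tau> powr (2 - \<alpha>)"
proof -
  define t a where "t = (real n - 1/2) * \<tau>" and "a = (real n - 1) * \<tau>"
  define d where "d = backward_diff \<tau> (g 0)"
  define S where "S = (\<Sum>k=1..n-1. coeff_a \<alpha> (n - k) * d k + coeff_b \<alpha> (n - k) * (d (Suc k) - d k))"
  let ?w = "\<lambda>s. (t - s) powr (-\<alpha>) * g 1 s"
  let ?\<kappa> = "\<tau> powr (1 - \<alpha>) / (1 - \<alpha>)"
  have a: "real (n - 1) * \<tau> = a" "0 \<le> a" using assms by (auto simp: a_def)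
  have ta: "t - a = \<tau> / 2" by (simp add: t_def a_def algebra_simps)
  have n\<tau>: "real n * \<tau> = a + \<tau>" by (simp add: a_def algebra_simps)
  have at: "a \<le> t" "0 < t" "t < T" "\<tau> \<le> T" using a ta n\<tau> assms by linarith+
  have M0: "0 \<le> M" using M(1)[of 0] at by auto
  have cont: "continuous_on {0..T} (g 1)"
    using deriv[of _ 1] by (intro DERIV_continuous_on) auto
  have cont_t: "continuous_on {0..t} (g 1)" "continuous_on {a..t} (g 1)"
    by (rule continuous_on_subset[OF cont], use a at in simp)+

  \<comment> \<open>As \<open>t < T\<close>, every \<open>s\<close> other than 0 is interior to
    \<open>{0..T}\<close>, where the derivative within the interval is the two-sided one. The point
    0 is negligible for the integral.\<close>
  have "deriv (g 0) s = g 1 s" if "s \<in> {0..t} - {0}" for s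
  proof -
    have "at s within {0..T} = at s"
      using that at by (intro at_within_interior) auto
    then show ?thesis
      using deriv[of s 0] that at by (intro DERIV_imp_deriv) auto
  qed
  then have caputo: "caputo \<alpha> (g 0) t = 1 / Gamma (1 - \<alpha>) * integral {0..t} ?w"
    unfolding caputo_def by (intro arg_cong2[of _ _ _ _ "(*)"] integral_spike[of "{0}"]) auto

  have "1 - \<alpha> \<notin> \<int>\<^sub>\<le>\<^sub>0"
    using assms(2) by (auto dest: nonpos_Ints_nonpos)
  then have Gamma: "Gamma (2 - \<alpha>) = (1 - \<alpha>) * Gamma (1 - \<alpha>)" "0 < Gamma (2 - \<alpha>)"
    using Gamma_plus1[of "1 - \<alpha>"] assms by (auto simp: Gamma_real_pos add.commute)
  have discr: "caputo_discr \<alpha> \<tau> (g 0) n = 1 / Gamma (1 - \<alpha>) * (?\<kappa> * (S + coeff_a \<alpha> 0 * d n))"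
    using caputo_discr_sum[OF \<open>1 \<le> n\<close>, of \<alpha> d]
    unfolding caputo_discr_def d_def[symmetric] S_def Gamma by (simp add: add.commute)

  have history: "\<bar>integral {0..a} ?w - ?\<kappa> * S\<bar>
      \<le> 16 * M * \<tau>\<^sup>2 * ((t powr (1 - \<alpha>) - (t - a) powr (1 - \<alpha>)) / (1 - \<alpha>))"
    using history_error[OF assms(2) deriv M(2) assms(6,8), of "n - 1"] assms(7)
    unfolding S_def d_def t_def[symmetric] a(1) by simp
  have last: "\<bar>integral {a..t} ?w - ?\<kappa> * (coeff_a \<alpha> 0 * d n)\<bar>
      \<le> 2 * M * \<tau> * (((t - a) powr (1 - \<alpha>) - (t - t) powr (1 - \<alpha>)) / (1 - \<alpha>))"
  proof (rule powr_kernel_integral_diff_le[OF assms(2) at(1) order_refl cont_t(2)])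
    \<comment> \<open>The last piece has length \<open>\<tau> / 2\<close>; this is the origin of the
      value \<open>(1/2) powr (1 - \<alpha>)\<close> of \<open>coeff_a\<close> at 0.\<close>
    have "((t - a) powr (1 - \<alpha>) - (t - t) powr (1 - \<alpha>)) / (1 - \<alpha>) * d n = ?\<kappa> * (coeff_a \<alpha> 0 * d n)"
      using assms by (simp add: ta coeff_a_def powr_divide)
    then show "((\<lambda>s. (t - s) powr (-\<alpha>) * d n) has_integral ?\<kappa> * (coeff_a \<alpha> 0 * d n)) {a..t}"
      using has_integral_mult_left[OF powr_kernel_has_integral[OF assms(2) at(1) order_refl], of "d n"]
      by (simp only:)
    show "\<bar>g 1 s - d n\<bar> \<le> 2 * M * \<tau>" if "s \<in> {a..t}" for s
      unfolding d_def
      by (rule backward_diff_error[OF deriv M(1) assms(6-8)])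
         (use that ta n\<tau> \<open>0 < \<tau>\<close> in \<open>auto simp: a_def[symmetric]\<close>)
  qed

  have T_pow: "t powr (1 - \<alpha>) \<le> T powr (1 - \<alpha>)"
    using at assms by (intro powr_mono2) auto
  have "16 * M * \<tau>\<^sup>2 * (t powr (1 - \<alpha>) - (t - a) powr (1 - \<alpha>)) \<le> 16 * M * \<tau>\<^sup>2 * T powr (1 - \<alpha>)"
    using T_pow M0 by (intro mult_left_mono) (auto intro: order_trans[of _ "t powr (1 - \<alpha>)"])
  \<comment> \<open>The history error is of order \<open>\<tau>\<^sup>2\<close>. The surplus
    \<open>\<tau> powr \<alpha>\<close> is traded for \<open>T powr \<alpha>\<close>, using
    \<open>\<tau> \<le> T\<close>, to reach the common order
    \<open>\<tau> powr (2 - \<alpha>)\<close>.\<close>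
  also have "16 * M * \<tau>\<^sup>2 * T powr (1 - \<alpha>)
      = 16 * M * (\<tau> powr (2 - \<alpha>) * \<tau> powr \<alpha>) * T powr (1 - \<alpha>)"
    using \<open>0 < \<tau>\<close> by (simp flip: powr_add)
  also have "\<dots> \<le> 16 * M * (\<tau> powr (2 - \<alpha>) * T powr \<alpha>) * T powr (1 - \<alpha>)"
    using M0 at assms by (intro mult_left_mono mult_right_mono powr_mono2) auto
  also have "\<dots> = 16 * M * \<tau> powr (2 - \<alpha>) * (T powr \<alpha> * T powr (1 - \<alpha>))"
    by (simp add: mult_ac)
  also have "T powr \<alpha> * T powr (1 - \<alpha>) = T"
    using at by (simp flip: powr_add)
  finally have bound1: "16 * M * \<tau>\<^sup>2 * (t powr (1 - \<alpha>) - (t - a) powr (1 - \<alpha>)) \<le> 16 * M * \<tau> powr (2 - \<alpha>) * T" .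
  have "(\<tau> / 2) powr (1 - \<alpha>) \<le> \<tau> powr (1 - \<alpha>)"
    using assms by (intro powr_mono2) auto
  then have "2 * M * \<tau> * (\<tau> / 2) powr (1 - \<alpha>) \<le> 2 * M * \<tau> * \<tau> powr (1 - \<alpha>)"
    using M0 assms by (intro mult_left_mono) auto
  also have "\<dots> = 2 * M * \<tau> powr (2 - \<alpha>)"
    using assms powr_add[of \<tau> 1 "1 - \<alpha>"] by simp
  finally have bound2: "2 * M * \<tau> * ((t - a) powr (1 - \<alpha>) - (t - t) powr (1 - \<alpha>)) \<le> 2 * M * \<tau> powr (2 - \<alpha>)"
    by (simp add: ta)

  have "?w integrable_on {0..t}"
    using at cont_t by (intro powr_kernel_continuous_integrable assms(2)) auto
  then have split: "integral {0..t} ?w = integral {0..a} ?w + integral {a..t} ?w"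
    using a at by (simp add: Henstock_Kurzweil_Integration.integral_combine)
  have "\<bar>integral {0..t} ?w - ?\<kappa> * (S + coeff_a \<alpha> 0 * d n)\<bar>
      \<le> \<bar>integral {0..a} ?w - ?\<kappa> * S\<bar> + \<bar>integral {a..t} ?w - ?\<kappa> * (coeff_a \<alpha> 0 * d n)\<bar>"
    unfolding split distrib_left add_diff_add by (rule abs_triangle_ineq)
  also have "\<dots> \<le> 16 * M * \<tau>\<^sup>2 * ((t powr (1 - \<alpha>) - (t - a) powr (1 - \<alpha>)) / (1 - \<alpha>))
      + 2 * M * \<tau> * (((t - a) powr (1 - \<alpha>) - (t - t) powr (1 - \<alpha>)) / (1 - \<alpha>))"
    by (intro add_mono history last)
  also have "\<dots> = (16 * M * \<tau>\<^sup>2 * (t powr (1 - \<alpha>) - (t - a) powr (1 - \<alpha>))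
      + 2 * M * \<tau> * ((t - a) powr (1 - \<alpha>) - (t - t) powr (1 - \<alpha>))) / (1 - \<alpha>)"
    by (simp add: add_divide_distrib)
  also have "\<dots> \<le> (16 * M * \<tau> powr (2 - \<alpha>) * T + 2 * M * \<tau> powr (2 - \<alpha>)) / (1 - \<alpha>)"
    using assms by (intro divide_right_mono add_mono bound1 bound2) auto
  finally have main: "\<bar>integral {0..t} ?w - ?\<kappa> * (S + coeff_a \<alpha> 0 * d n)\<bar>
      \<le> (16 * M * \<tau> powr (2 - \<alpha>) * T + 2 * M * \<tau> powr (2 - \<alpha>)) / (1 - \<alpha>)" .
  have "0 < Gamma (1 - \<alpha>)" using assms by (simp add: Gamma_real_pos)
  then have "\<bar>caputo \<alpha> (g 0) t - caputo_discr \<alpha> \<tau> (g 0) n\<bar>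
      = \<bar>integral {0..t} ?w - ?\<kappa> * (S + coeff_a \<alpha> 0 * d n)\<bar> / Gamma (1 - \<alpha>)"
    unfolding caputo discr right_diff_distrib[symmetric] abs_mult by simp
  also have "\<dots> \<le> (16 * M * \<tau> powr (2 - \<alpha>) * T + 2 * M * \<tau> powr (2 - \<alpha>)) / (1 - \<alpha>) / Gamma (1 - \<alpha>)"
    using main \<open>0 < Gamma (1 - \<alpha>)\<close> by (intro divide_right_mono) auto
  also have "\<dots> = (16 * T + 2) * M / Gamma (2 - \<alpha>) * \<tau> powr (2 - \<alpha>)"
    unfolding Gamma by (simp add: algebra_simps)
  finally show ?thesis unfolding t_def .
qed

section \<open>Uniformity over the spatial mesh\<close>

theorem lemma3p1:
  fixes \<alpha> Lx Ly T :: real and u :: "real \<Rightarrow> real \<Rightarrow> real \<Rightarrow> real"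
  assumes "0 < \<alpha>" and "\<alpha> < 1"
    and "0 < Lx" and "0 < Ly" and "0 < T"
    and "C003 ({0..Lx} \<times> {0..Ly}) {0..T} u"
  shows "\<exists>C>0. \<forall>(Mx::nat) (My::nat) (N::nat) (i::nat) (j::nat) (n::nat).
           1 \<le> Mx \<longrightarrow> 1 \<le> My \<longrightarrow> 1 \<le> N \<longrightarrow> i \<le> Mx \<longrightarrow> j \<le> My \<longrightarrow> 1 \<le> n \<longrightarrow> n \<le> N \<longrightarrow>
           (let hx = Lx / real Mx; hy = Ly / real My; \<tau> = T / real N;
                f = u (real i * hx) (real j * hy)
            in \<bar>caputo \<alpha> f ((real n - 1/2) * \<tau>) - caputo_discr \<alpha> \<tau> f n\<bar>
                 \<le> C * \<tau> powr (2 - \<alpha>))"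
proof -
  let ?S = "{0..Lx} \<times> {0..Ly}"
  obtain D where D0: "D 0 = u"
    and deriv: "\<And>m x y t. m < 3 \<Longrightarrow> (x, y) \<in> ?S \<Longrightarrow> t \<in> {0..T} \<Longrightarrow>
        (D m x y has_real_derivative D (Suc m) x y t) (at t within {0..T})"
    and cont: "\<And>m. m \<le> 3 \<Longrightarrow> continuous_on (?S \<times> {0..T}) (\<lambda>((x, y), t). D m x y t)"
    using assms(6) unfolding C003_def by blast
  have bdd: "\<exists>M. \<forall>x y t. (x, y) \<in> ?S \<longrightarrow> t \<in> {0..T} \<longrightarrow> \<bar>D m x y t\<bar> \<le> M" if "m \<le> 3" for m
  proof -
    \<comment> \<open>The closed space-time box is compact, so joint continuity gives one bound
      valid at all spatial points.\<close>
    have "compact ((\<lambda>((x, y), t). D m x y t) ` (?S \<times> {0..T}))"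
      by (intro compact_continuous_image cont that compact_Times compact_Icc)
    then obtain M where M: "\<And>z. z \<in> (\<lambda>((x, y), t). D m x y t) ` (?S \<times> {0..T}) \<Longrightarrow> norm z \<le> M"
      by (meson bounded_iff compact_imp_bounded)
    have "\<bar>D m x y t\<bar> \<le> M" if "(x, y) \<in> ?S" "t \<in> {0..T}" for x y t
      using M[of "D m x y t"] that by force
    then show ?thesis by blast
  qed
  obtain M2 M3 where M2: "\<And>x y t. (x, y) \<in> ?S \<Longrightarrow> t \<in> {0..T} \<Longrightarrow> \<bar>D 2 x y t\<bar> \<le> M2"
    and M3: "\<And>x y t. (x, y) \<in> ?S \<Longrightarrow> t \<in> {0..T} \<Longrightarrow> \<bar>D 3 x y t\<bar> \<le> M3"
    using bdd[of 2] bdd[of 3] that by simp metis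
  \<comment> \<open>The maximum with 1 keeps the final constant positive even if the second and
    third time derivatives vanish.\<close>
  define M where "M = max 1 (max M2 M3)"
  have Gamma: "0 < Gamma (2 - \<alpha>)"
    using assms by (simp add: Gamma_real_pos)
  show ?thesis
  proof (intro exI[of _ "(16 * T + 2) * M / Gamma (2 - \<alpha>)"] conjI allI impI)
    show "0 < (16 * T + 2) * M / Gamma (2 - \<alpha>)"
      using Gamma \<open>0 < T\<close> by (auto simp: M_def intro!: divide_pos_pos mult_pos_pos)
    fix Mx My N i j n :: nat
    assume h: "1 \<le> Mx" "1 \<le> My" "1 \<le> N" "i \<le> Mx" "j \<le> My" "1 \<le> n" "n \<le> N"
    define x y \<tau> where "x = real i * (Lx / real Mx)" and "y = real j * (Ly / real My)" and "\<tau> = T / real N"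
    have xy: "(x, y) \<in> ?S"
      using h assms by (auto simp: x_def y_def field_simps)
    have "0 < \<tau>" "real n * \<tau> \<le> T"
      using h assms by (auto simp: \<tau>_def field_simps)
    then have "\<bar>caputo \<alpha> (D 0 x y) ((real n - 1/2) * \<tau>) - caputo_discr \<alpha> \<tau> (D 0 x y) n\<bar>
        \<le> (16 * T + 2) * M / Gamma (2 - \<alpha>) * \<tau> powr (2 - \<alpha>)"
      using deriv[OF _ xy] M2[OF xy] M3[OF xy] h assms
      by (intro caputo_discr_error[where g = "\<lambda>m. D m x y"]) (auto simp: M_def le_max_iff_disj)
    then show "let hx = Lx / real Mx; hy = Ly / real My; \<tau> = T / real N;
                f = u (real i * hx) (real j * hy)
            in \<bar>caputo \<alpha> f ((real n - 1/2) * \<tau>) - caputo_discr \<alpha> \<tau> f n\<bar>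
                 \<le> (16 * T + 2) * M / Gamma (2 - \<alpha>) * \<tau> powr (2 - \<alpha>)"
      unfolding Let_def D0 x_def y_def \<tau>_def .
  qed
qed

end
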